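(* There exist a number of agents $n$ and an admissible distribution $P$ on $[0,1]^n$ such that, under the egalitarian welfare $w_{-\infty}(B)=\min_{i}B^i$, every fluid policy $\mathsf F$ satisfies $$\mathcal{R}_T(\mathsf{F})=\mathbb{E}\left[\mathsf{OPT}-\mathsf{ALG}(\mathsf{F})\right]=\Omega(\sqrt{T}),$$ i.e. $\liminf_{T\to\infty}\mathcal{R}_T(\mathsf{F})/\sqrt{T}>0$.
   Context: There are $n$ agents and $T$ periods. $\Delta_n=\{x\in\mathbb{R}_+^n:\sum_i x^i=1\}$. A distribution $P$ on $[0,1]^n$ is admissible if it has finite support: $P\{b=\beta_\ell\}=p_\ell>0$ for $\ell\in[L]=\{1,\dots,L\}$, with distinct $\beta_\ell\in[0,1]^n$ and $\sum_\ell p_\ell=1$. The marginal utility vectors $b_1,\dots,b_T$ are i.i.d. with law $P$; $N_\ell=\sum_{t=1}^T\mathbf{1}\{b_t=\beta_\ell\}$. Allocations $x_1,\dots,x_T\in\Delta_n$ give agent $i$ the cumulative utility $B_T^i=\sum_{t=1}^T b_t^i x_t^i$. Hindsight optimum: $\mathsf{OPT}=\max\left\{\min_i\sum_{t=1}^T b_t^i x_t^i: x_1,\dots,x_T\in\Delta_n\right\}$ for the realized sequence. A static policy $\boldsymbol\xi=(\xi_\ell)_{\ell\in[L]}\in\Delta_n^L$ allocates $x_t=\xi_\ell$ whenever $b_t=\beta_\ell$, so $B_T^i=\sum_\ell N_\ell\beta_\ell^i\xi_\ell^i$, and $\mathsf{ALG}(\boldsymbol\xi)=\min_i B_T^i$.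 A fluid policy $\mathsf{F}$ is a static policy that is an optimal solution of $\max\left\{\min_i T\sum_{\ell}p_\ell\beta_\ell^i\xi_\ell^i:\boldsymbol\xi\in\Delta_n^L\right\}$ (the set of optimal solutions does not depend on $T$). *)

theory Defs
  imports "HOL-Probability.Probability"
begin

text \<open>
  Agents are \<open>0, \<dots>, n - 1\<close> and periods are \<open>0, \<dots>, T - 1\<close>.  A vector in \<open>\<real>\<^sup>n\<close> is
  an extensional function on \<open>{..<n}\<close>, so distinct functions are distinct vectors.  The index of
  an atom of a finitely supported distribution is the atom itself: \<open>\<beta>\<close> ranges over
  \<open>set_pmf P\<close> and has probability \<open>pmf P \<beta> > 0\<close>.
\<close>

type_synonym vec = "nat \<Rightarrow> real"
type_synonym policy = "vec \<Rightarrow> vec"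

definition prob_simplex :: "nat \<Rightarrow> vec set" where
  "prob_simplex n = {x \<in> {..<n} \<rightarrow>\<^sub>E {0..}. (\<Sum>i<n. x i) = 1}"

definition admissible :: "nat \<Rightarrow> vec pmf \<Rightarrow> bool" where
  "admissible n P \<longleftrightarrow> finite (set_pmf P) \<and> set_pmf P \<subseteq> ({..<n} \<rightarrow>\<^sub>E {0..1})"

definition egalitarian :: "nat \<Rightarrow> vec \<Rightarrow> real" where
  "egalitarian n B = Min (B ` {..<n})"

definition cum_utility :: "nat \<Rightarrow> (nat \<Rightarrow> vec) \<Rightarrow> (nat \<Rightarrow> vec) \<Rightarrow> vec" where
  "cum_utility T b x = (\<lambda>i. \<Sum>t<T. b t i * x t i)"

text \<open>The supremum is attained, see \<open>OPT_attained\<close> below.\<close>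

definition OPT :: "nat \<Rightarrow> nat \<Rightarrow> (nat \<Rightarrow> vec) \<Rightarrow> real" where
  "OPT n T b = (SUP x \<in> {..<T} \<rightarrow>\<^sub>E prob_simplex n. egalitarian n (cum_utility T b x))"

definition static_policies :: "nat \<Rightarrow> vec pmf \<Rightarrow> policy set" where
  "static_policies n P = set_pmf P \<rightarrow>\<^sub>E prob_simplex n"

definition ALG :: "nat \<Rightarrow> nat \<Rightarrow> policy \<Rightarrow> (nat \<Rightarrow> vec) \<Rightarrow> real" where
  "ALG n T \<xi> b = egalitarian n (cum_utility T b (\<lambda>t. \<xi> (b t)))"

definition fluid_objective :: "nat \<Rightarrow> vec pmf \<Rightarrow> nat \<Rightarrow> policy \<Rightarrow> real" where
  "fluid_objective n P T \<xi> =
     egalitarian n (\<lambda>i. real T * (\<Sum>\<beta>\<in>set_pmf P. pmf P \<beta> * \<beta> i * \<xi> \<beta> i))"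

definition fluid_policies :: "nat \<Rightarrow> vec pmf \<Rightarrow> nat \<Rightarrow> policy set" where
  "fluid_policies n P T =
     {\<xi> \<in> static_policies n P.
        \<forall>\<zeta> \<in> static_policies n P. fluid_objective n P T \<zeta> \<le> fluid_objective n P T \<xi>}"

text \<open>
  The law of the i.i.d. sequence \<open>b\<^sub>0, \<dots>, b\<^bsub>T-1\<^esub>\<close>; the value \<open>undefined\<close> is taken only at
  indices outside \<open>{..<T}\<close>, which are never used.
\<close>

definition iid_seq :: "nat \<Rightarrow> vec pmf \<Rightarrow> (nat \<Rightarrow> vec) pmf" where
  "iid_seq T P = Pi_pmf {..<T} undefined (\<lambda>_. P)"

definition regret :: "nat \<Rightarrow> vec pmf \<Rightarrow> nat \<Rightarrow> policy \<Rightarrow> real" where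
  "regret n P T \<xi> = measure_pmf.expectation (iid_seq T P) (\<lambda>b. OPT n T b - ALG n T \<xi> b)"


text \<open>Sanity checks: cumulative utilities of static policies in terms of the counts \<open>N\<^sub>\<beta>\<close>,
  attainment of both maxima, and independence of the fluid policies from the horizon.\<close>

lemma cum_utility_static:
  assumes "finite (set_pmf P)" "\<And>t. t < T \<Longrightarrow> b t \<in> set_pmf P"
  shows "cum_utility T b (\<lambda>t. \<xi> (b t)) i =
    (\<Sum>\<beta>\<in>set_pmf P. real (card {t. t < T \<and> b t = \<beta>}) * \<beta> i * \<xi> \<beta> i)"
proof -
  have "(\<Sum>t<T. b t i * \<xi> (b t) i) =
        (\<Sum>\<beta>\<in>set_pmf P. \<Sum>t\<in>{t\<in>{..<T}. b t = \<beta>}. b t i * \<xi> (b t) i)"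
    by (rule sum.group [symmetric]) (use assms in auto)
  also have "\<dots> = (\<Sum>\<beta>\<in>set_pmf P. real (card {t. t < T \<and> b t = \<beta>}) * \<beta> i * \<xi> \<beta> i)"
    by (intro sum.cong refl) (simp add: mult.assoc)
  finally show ?thesis by (simp add: cum_utility_def)
qed

lemma compact_PiE:
  fixes S :: "'i \<Rightarrow> 'a::topological_space set"
  assumes "\<And>i. i \<in> I \<Longrightarrow> compact (S i)"
  shows "compact (PiE I S)"
proof -
  have eq: "PiE I S = PiE UNIV (\<lambda>i. if i \<in> I then S i else {undefined})"
    by (auto simp: PiE_iff extensional_def split: if_splits)
  show ?thesis
    unfolding eq compactin_euclidean_iff [symmetric] euclidean_product_topology [symmetric]
      compactin_PiE
    using assms by auto
qed

lemma compact_prob_simplex: "compact (prob_simplex n)"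
proof -
  have "prob_simplex n = ({..<n} \<rightarrow>\<^sub>E {0..1}) \<inter> {x. (\<Sum>i<n. x i) = 1}"
  proof (intro set_eqI iffI)
    fix x assume x: "x \<in> prob_simplex n"
    have "x i \<le> 1" if "i < n" for i
    proof -
      have "x i \<le> (\<Sum>i<n. x i)"
        using x that by (intro member_le_sum) (auto simp: prob_simplex_def PiE_iff)
      then show ?thesis using x by (simp add: prob_simplex_def)
    qed
    then show "x \<in> ({..<n} \<rightarrow>\<^sub>E {0..1}) \<inter> {x. (\<Sum>i<n. x i) = 1}"
      using x by (auto simp: prob_simplex_def PiE_iff)
  qed (auto simp: prob_simplex_def PiE_iff)
  moreover have "closed {x::vec. (\<Sum>i<n. x i) = 1}"
    by (intro closed_Collect_eq continuous_intros) auto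
  ultimately show ?thesis
    by (simp add: compact_Int_closed compact_PiE)
qed

lemma prob_simplex_nonempty:
  assumes "n \<ge> 1"
  shows "prob_simplex n \<noteq> {}"
proof -
  let ?x = "\<lambda>i. if i < n then if i = 0 then 1 else 0 else undefined :: real"
  have "(\<Sum>i<n. ?x i) = (\<Sum>i<n. if i = 0 then 1 else 0)"
    by (intro sum.cong) auto
  also have "\<dots> = 1" using assms by simp
  finally have "?x \<in> prob_simplex n"
    by (auto simp: prob_simplex_def PiE_iff extensional_def)
  then show ?thesis by blast
qed

lemma continuous_on_egalitarian:
  fixes f :: "'a::topological_space \<Rightarrow> vec"
  assumes "n \<ge> 1" "\<And>i. i < n \<Longrightarrow> continuous_on S (\<lambda>x. f x i)"
  shows "continuous_on S (\<lambda>x. egalitarian n (f x))"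
  using assms
proof (induction n rule: dec_induct)
  case base
  then show ?case by (simp add: egalitarian_def lessThan_Suc)
next
  case (step n)
  have "egalitarian (Suc n) (f x) = min (f x n) (egalitarian n (f x))" for x
    using step.hyps by (auto simp: egalitarian_def lessThan_Suc lessThan_empty_iff)
  then show ?case
    using step by (auto intro!: continuous_on_min)
qed

lemma continuous_on_eval2: "continuous_on S (\<lambda>x :: 'i \<Rightarrow> 'j \<Rightarrow> real. x t i)"
  by (rule continuous_on_product_then_coordinatewise
        [OF continuous_on_product_then_coordinatewise [OF continuous_on_id]])

lemma OPT_attained:
  assumes "n \<ge> 1"
  shows "\<exists>x \<in> {..<T} \<rightarrow>\<^sub>E prob_simplex n.
    OPT n T b = egalitarian n (cum_utility T b x) \<and>
    (\<forall>y \<in> {..<T} \<rightarrow>\<^sub>E prob_simplex n.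
       egalitarian n (cum_utility T b y) \<le> egalitarian n (cum_utility T b x))"
proof -
  let ?X = "{..<T} \<rightarrow>\<^sub>E prob_simplex n"
  have "?X \<noteq> {}" using prob_simplex_nonempty [OF assms] by (simp add: PiE_eq_empty_iff)
  moreover have "continuous_on ?X (\<lambda>x. egalitarian n (cum_utility T b x))"
    unfolding cum_utility_def
    by (intro continuous_on_egalitarian assms continuous_intros continuous_on_eval2)
  ultimately obtain x where x: "x \<in> ?X"
    "\<forall>y \<in> ?X. egalitarian n (cum_utility T b y) \<le> egalitarian n (cum_utility T b x)"
    using continuous_attains_sup [of ?X] compact_PiE compact_prob_simplex by metis
  then have "OPT n T b = egalitarian n (cum_utility T b x)"
    unfolding OPT_def by (intro cSup_eq_maximum) auto
  with x show ?thesis by blast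
qed

lemma fluid_policies_nonempty:
  assumes "n \<ge> 1"
  shows "fluid_policies n P T \<noteq> {}"
proof -
  let ?X = "static_policies n P"
  have "?X \<noteq> {}"
    using prob_simplex_nonempty [OF assms] by (simp add: static_policies_def PiE_eq_empty_iff)
  moreover have "continuous_on ?X (fluid_objective n P T)"
    unfolding fluid_objective_def
    by (intro continuous_on_egalitarian assms continuous_intros continuous_on_eval2)
  moreover have "compact ?X"
    unfolding static_policies_def by (intro compact_PiE compact_prob_simplex)
  ultimately show ?thesis
    using continuous_attains_sup [of ?X] by (fastforce simp: fluid_policies_def)
qed

lemma fluid_policies_horizon:
  assumes "n \<ge> 1" "T \<ge> 1"
  shows "fluid_policies n P T = fluid_policies n P 1"
proof -
  have "fluid_objective n P T \<xi> = real T * fluid_objective n P 1 \<xi>" for \<xi>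
  proof -
    define g where "g i = (\<Sum>\<beta>\<in>set_pmf P. pmf P \<beta> * \<beta> i * \<xi> \<beta> i)" for i
    have "real T * Min (g ` {..<n}) = Min ((*) (real T) ` (g ` {..<n}))"
      using assms
      by (intro mono_Min_commute monoI mult_left_mono) (auto simp: lessThan_empty_iff)
    then show ?thesis
      by (simp add: fluid_objective_def egalitarian_def image_image flip: g_def)
  qed
  then show ?thesis using assms by (simp add: fluid_policies_def)
qed

end

theory Submission
  imports Defs
begin

text \<open>
  Two agents: with probability 1/2 only agent 0 values the item, and with probability 1/2 both
  agents do.  The fluid optimum must give every contested item to agent 1, so agent 0 is left with
  the uncontested ones.  If \<open>T/2 + S/2\<close> items are contested and \<open>S \<ge> 0\<close>, splitting them in
  hindsight guarantees \<open>T/2\<close>, whereas the fluid policy gets at most \<open>T/2 - S/2\<close>.  Here \<open>S\<close> is a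
  simple symmetric random walk, and comparing its second and fourth moments shows that its
  positive part has expectation of order \<open>\<surd>T\<close>.
\<close>

section \<open>Allocations and i.i.d. sequences\<close>

lemma egalitarian_2: "egalitarian 2 B = min (B 0) (B 1)"
  by (simp add: egalitarian_def numeral_2_eq_2 lessThan_Suc min.commute)

lemma prob_simplex_2:
  "x \<in> prob_simplex 2 \<longleftrightarrow>
     x \<in> extensional {..<2} \<and> 0 \<le> x 0 \<and> 0 \<le> x 1 \<and> x 0 + x 1 = 1"
  by (auto simp: prob_simplex_def PiE_iff numeral_2_eq_2 lessThan_Suc add.commute)

text \<open>Lets allocations be written without \<open>restrict\<close>: values outside
  \<open>{..<T}\<close> do not enter the cumulative utility.\<close>

lemma OPT_ge:
  assumes "n \<ge> 1" "\<And>t. t < T \<Longrightarrow> x t \<in> prob_simplex n"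
  shows "egalitarian n (cum_utility T b x) \<le> OPT n T b"
proof -
  have "restrict x {..<T} \<in> {..<T} \<rightarrow>\<^sub>E prob_simplex n"
    using assms by auto
  moreover have "cum_utility T b (restrict x {..<T}) = cum_utility T b x"
    by (auto simp: cum_utility_def)
  ultimately show ?thesis
    using OPT_attained [OF assms(1), of T b] by metis
qed

lemma iid_seq_in_support:
  assumes "b \<in> set_pmf (iid_seq T P)" "t < T"
  shows "b t \<in> set_pmf P"
  using assms set_Pi_pmf_subset' [of "{..<T}" undefined "\<lambda>_. P"]
  by (auto simp: iid_seq_def PiE_dflt_def)

lemma finite_set_pmf_iid_seq:
  assumes "finite (set_pmf P)"
  shows "finite (set_pmf (iid_seq T P))"
  unfolding iid_seq_def
  by (rule finite_subset [OF set_Pi_pmf_subset']) (auto intro: finite_PiE_dflt assms)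

lemma integrable_iid_seq:
  fixes f :: "_ \<Rightarrow> real"
  assumes "finite (set_pmf P)"
  shows "integrable (measure_pmf (iid_seq T P)) f"
  by (intro integrable_measure_pmf_finite finite_set_pmf_iid_seq assms)

lemma iid_seq_Suc:
  "iid_seq (Suc T) P = bind_pmf P (\<lambda>y. map_pmf (\<lambda>b. b(T := y)) (iid_seq T P))"
  by (simp add: iid_seq_def lessThan_Suc Pi_pmf_insert' map_pmf_def)

section \<open>Moments and positive part of the symmetric random walk\<close>

definition walk :: "vec \<Rightarrow> nat \<Rightarrow> (nat \<Rightarrow> vec) \<Rightarrow> real" where
  "walk c T b = (\<Sum>t<T. if b t = c then 1 else -1)"

text \<open>Conditioning on the last period: its increment is a fair sign independent of the earlier
  ones. Applied to powers, this gives recursions for the moments.\<close>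

lemma expectation_walk_Suc:
  fixes f :: "real \<Rightarrow> real"
  assumes "a \<noteq> c"
  defines "P \<equiv> pmf_of_set {a, c}"
  shows "measure_pmf.expectation (iid_seq (Suc T) P) (\<lambda>b. f (walk c (Suc T) b)) =
    measure_pmf.expectation (iid_seq T P)
      (\<lambda>b. (f (walk c T b + 1) + f (walk c T b - 1)) / 2)"
proof -
  have fin: "finite (set_pmf P)" by (simp add: P_def)
  have upd: "walk c (Suc T) (b(T := y)) = walk c T b + (if y = c then 1 else -1)" for b y
    by (simp add: walk_def)
  have "measure_pmf.expectation (iid_seq (Suc T) P) (\<lambda>b. f (walk c (Suc T) b)) =
    (\<Sum>y\<in>set_pmf P. pmf P y *
       measure_pmf.expectation (iid_seq T P) (\<lambda>b. f (walk c (Suc T) (b(T := y)))))"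
    unfolding iid_seq_Suc
    by (subst pmf_expectation_bind [where A = "set_pmf P"])
       (auto simp: fin finite_set_pmf_iid_seq)
  also have "\<dots> = measure_pmf.expectation (iid_seq T P) (\<lambda>b. f (walk c T b - 1)) / 2
      + measure_pmf.expectation (iid_seq T P) (\<lambda>b. f (walk c T b + 1)) / 2"
    using assms(1) by (simp add: upd P_def)
  also have "\<dots> = measure_pmf.expectation (iid_seq T P)
      (\<lambda>b. (f (walk c T b + 1) + f (walk c T b - 1)) / 2)"
    by (simp add: integrable_iid_seq fin add_divide_distrib)
  finally show ?thesis .
qed

text \<open>By induction on \<open>T\<close>: averaging over the signs cancels the odd powers of the
  increment. The fourth moment thus grows by \<open>6 * T + 1\<close>, six times the second moment
  plus one.\<close>

lemma walk_moments:
  assumes "a \<noteq> c"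
  defines "P \<equiv> pmf_of_set {a, c}"
  shows "measure_pmf.expectation (iid_seq T P) (walk c T) = 0"
    and "measure_pmf.expectation (iid_seq T P) (\<lambda>b. walk c T b ^ 2) = T"
    and "measure_pmf.expectation (iid_seq T P) (\<lambda>b. walk c T b ^ 4) = 3 * real T ^ 2 - 2 * real T"
proof -
  note step = expectation_walk_Suc [OF assms(1), folded P_def]
  have int: "integrable (measure_pmf (iid_seq T P)) f" for T and f :: "_ \<Rightarrow> real"
    by (simp add: integrable_iid_seq P_def)
  show "measure_pmf.expectation (iid_seq T P) (walk c T) = 0"
  proof (induction T)
    case (Suc T)
    then show ?case using step [of T "\<lambda>s. s"] by simp
  qed (simp add: walk_def)
  have m2: "measure_pmf.expectation (iid_seq T P) (\<lambda>b. walk c T b ^ 2) = T" for T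
  proof (induction T)
    case (Suc T)
    have eq: "((s + 1)\<^sup>2 + (s - 1)\<^sup>2) / 2 = s\<^sup>2 + 1" for s :: real
      by (simp add: power2_eq_square field_simps)
    show ?case
      unfolding step [of T "\<lambda>s. s ^ 2"] eq using Suc by (simp add: int)
  qed (simp add: walk_def)
  then show "measure_pmf.expectation (iid_seq T P) (\<lambda>b. walk c T b ^ 2) = T" .
  show "measure_pmf.expectation (iid_seq T P) (\<lambda>b. walk c T b ^ 4) = 3 * real T ^ 2 - 2 * real T"
  proof (induction T)
    case (Suc T)
    have eq: "((s + 1) ^ 4 + (s - 1) ^ 4) / 2 = s ^ 4 + 6 * s\<^sup>2 + 1" for s :: real
      by (simp add: power2_eq_square power4_eq_xxxx field_simps)
    show ?case
      unfolding step [of T "\<lambda>s. s ^ 4"] eq using Suc m2 [of T]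
      by (simp add: int power2_eq_square field_simps)
  qed (simp add: walk_def)
qed

text \<open>With \<open>u = \<bar>s\<bar> / (2 r)\<close> this is \<open>u \<ge> u\<^sup>2 - u\<^sup>4\<close>.\<close>

lemma abs_ge_quartic:
  fixes r s :: real
  assumes "r > 0"
  shows "s\<^sup>2 / (2 * r) - s ^ 4 / (8 * r ^ 3) \<le> \<bar>s\<bar>"
proof -
  define u where "u = \<bar>s\<bar> / (2 * r)"
  have u: "u \<ge> 0" and s: "\<bar>s\<bar> = 2 * r * u" using assms by (auto simp: u_def)
  have "u\<^sup>2 - u ^ 4 \<le> u"
  proof (cases "u \<le> 1")
    case True
    then have "u\<^sup>2 \<le> u" using u by (simp add: power2_eq_square mult_left_le)
    moreover have "u ^ 4 \<ge> 0" by simp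
    ultimately show ?thesis by linarith
  next
    case False
    then have "u\<^sup>2 \<le> u ^ 4" by (intro power_increasing) auto
    then show ?thesis using u by linarith
  qed
  then have "2 * r * (u\<^sup>2 - u ^ 4) \<le> 2 * r * u" using assms by (intro mult_left_mono) auto
  moreover have "s\<^sup>2 = (2 * r * u)\<^sup>2" "s ^ 4 = (2 * r * u) ^ 4"
    using s by (metis power2_abs, metis power_even_abs_numeral even_numeral)
  then have "s\<^sup>2 / (2 * r) - s ^ 4 / (8 * r ^ 3) = 2 * r * (u\<^sup>2 - u ^ 4)"
    using assms by (simp add: field_simps power2_eq_square power3_eq_cube power4_eq_xxxx)
  ultimately show ?thesis using s by simp
qed

text \<open>The positive part of \<open>s\<close> is \<open>(s + \<bar>s\<bar>) / 2\<close>. The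
  linear term has mean zero, and \<open>\<bar>s\<bar>\<close> is replaced by its quartic minorant at
  scale \<open>r = sqrt T\<close>, whose mean is known from the moments.\<close>

lemma expectation_walk_pos_part:
  assumes "a \<noteq> c" "T \<ge> 1"
  shows "sqrt (real T) / 16 \<le>
    measure_pmf.expectation (iid_seq T (pmf_of_set {a, c})) (\<lambda>b. max 0 (walk c T b))"
    (is "_ \<le> measure_pmf.expectation ?M _")
proof -
  define r where "r = sqrt (real T)"
  have r: "r > 0" and r2: "real T = r\<^sup>2" using assms by (auto simp: r_def)
  have int: "integrable (measure_pmf ?M) f" for f :: "_ \<Rightarrow> real"
    by (simp add: integrable_iid_seq)
  let ?g = "\<lambda>s. (s + (s\<^sup>2 / (2 * r) - s ^ 4 / (8 * r ^ 3))) / 2"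
  \<comment> \<open>The right side equals \<open>r / 16 + 1 / (8 * r)\<close>: the quadratic term
    gives \<open>r / 2\<close>, the quartic one costs less than \<open>3 * r / 8\<close>, and the
    result is halved.\<close>
  have "r / 16 \<le> (r\<^sup>2 / (2 * r) - (3 * r ^ 4 - 2 * r\<^sup>2) / (8 * r ^ 3)) / 2"
    using r by (simp add: field_simps power2_eq_square power3_eq_cube power4_eq_xxxx)
  also have "\<dots> = measure_pmf.expectation ?M (\<lambda>b. ?g (walk c T b))"
    using walk_moments [OF assms(1), of T] by (simp add: int r2 flip: power_mult)
  also have "\<dots> \<le> measure_pmf.expectation ?M (\<lambda>b. max 0 (walk c T b))"
  proof (intro integral_mono int)
    fix b
    show "?g (walk c T b) \<le> max 0 (walk c T b)"
      using abs_ge_quartic [OF r, of "walk c T b"] by (auto simp: max_def abs_if split: if_splits)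
  qed
  finally show ?thesis by (simp add: r_def)
qed

section \<open>The two-atom law and its fluid policies\<close>

definition sole :: vec where
  "sole = (\<lambda>i\<in>{..<2}. if i = 0 then 1 else 0)"

definition both :: vec where
  "both = (\<lambda>i\<in>{..<2}. 1)"

text \<open>On \<open>0 \<le> q \<le> 1\<close> this parametrizes the two-agent simplex by the share
  of agent 1.\<close>

definition share :: "real \<Rightarrow> vec" where
  "share q = (\<lambda>i\<in>{..<2}. if i = 0 then 1 - q else q)"

abbreviation law :: "vec pmf" where
  "law \<equiv> pmf_of_set {sole, both}"

lemma sole_simps [simp]: "sole 0 = 1" "sole (Suc 0) = 0"
  by (auto simp: sole_def)

lemma both_simps [simp]: "both 0 = 1" "both (Suc 0) = 1"
  by (auto simp: both_def)

lemma share_simps [simp]: "share q 0 = 1 - q" "share q (Suc 0) = q"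
  by (auto simp: share_def)

lemma sole_neq_both [simp]: "sole \<noteq> both" "both \<noteq> sole"
  using sole_simps(2) both_simps(2) by (metis zero_neq_one)+

lemma share_in_prob_simplex: "0 \<le> q \<Longrightarrow> q \<le> 1 \<Longrightarrow> share q \<in> prob_simplex 2"
  by (simp add: prob_simplex_2) (simp add: share_def)

lemma admissible_law: "admissible 2 law"
  by (auto simp: admissible_def sole_def both_def)

text \<open>Agent 1 gains only from \<open>both\<close>, so the objective at horizon 1 is at most
  \<open>F both 1 / 2\<close>. The policy \<open>?Z\<close> reaches \<open>1 / 2\<close>, which
  forces \<open>F both 1 = 1\<close>.\<close>

lemma fluid_policy_both:
  assumes "F \<in> fluid_policies 2 law T" "T \<ge> 1"
  shows "F both 0 = 0"
proof -
  have F: "F \<in> fluid_policies 2 law 1"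
    using assms fluid_policies_horizon [of 2 T law] by simp
  let ?Z = "\<lambda>\<beta>\<in>{sole, both}. share (if \<beta> = both then 1 else 0)"
  have "?Z \<in> static_policies 2 law"
    by (auto simp: static_policies_def intro!: share_in_prob_simplex)
  then have "fluid_objective 2 law 1 ?Z \<le> fluid_objective 2 law 1 F"
    using F by (auto simp: fluid_policies_def)
  then have "1 \<le> F both 1"
    by (simp add: fluid_objective_def egalitarian_2)
  moreover have "F both \<in> prob_simplex 2"
    using F by (auto simp: fluid_policies_def static_policies_def)
  ultimately show ?thesis by (auto simp: prob_simplex_2)
qed

section \<open>Hindsight optimum against fluid policy\<close>

lemma cum_utility_share:
  fixes q :: real
  assumes "\<And>t. t < T \<Longrightarrow> b t \<in> {sole, both}"
  defines "x \<equiv> (\<lambda>t. share (if b t = both then q else 0))"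
  shows "cum_utility T b x 0 = real T - q * (walk both T b + real T) / 2"
    and "cum_utility T b x 1 = q * (walk both T b + real T) / 2"
proof -
  \<comment> \<open>The indicator of \<open>both\<close> is half of the increment plus one, so the
    number of contested periods is \<open>(walk both T b + T) / 2\<close>.\<close>
  have "cum_utility T b x 0 = (\<Sum>t<T. 1 - q / 2 * ((if b t = both then 1 else -1) + 1))"
    unfolding cum_utility_def by (intro sum.cong refl) (use assms(1) in \<open>force simp: x_def\<close>)
  then show "cum_utility T b x 0 = real T - q * (walk both T b + real T) / 2"
    unfolding sum_subtractf sum_distrib_left [symmetric] sum.distrib walk_def by simp
  have "cum_utility T b x 1 = (\<Sum>t<T. q / 2 * ((if b t = both then 1 else -1) + 1))"
    unfolding cum_utility_def by (intro sum.cong refl) (use assms(1) in \<open>force simp: x_def\<close>)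
  then show "cum_utility T b x 1 = q * (walk both T b + real T) / 2"
    unfolding sum_distrib_left [symmetric] sum.distrib walk_def by simp
qed

lemma OPT_law_ge:
  assumes "\<And>t. t < T \<Longrightarrow> b t \<in> {sole, both}" "walk both T b \<ge> 0" "T \<ge> 1"
  shows "real T / 2 \<le> OPT 2 T b"
proof -
  \<comment> \<open>This split gives each agent exactly \<open>T / 2\<close>; it is a valid share
    because the walk is nonnegative.\<close>
  define q where "q = real T / (walk both T b + real T)"
  have q: "0 \<le> q" "q \<le> 1" and eq: "q * (walk both T b + real T) = real T"
    using assms by (auto simp: q_def)
  have "egalitarian 2 (cum_utility T b (\<lambda>t. share (if b t = both then q else 0))) = real T / 2"
    using cum_utility_share [of T b q, OF assms(1)] by (simp add: egalitarian_2 eq)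
  moreover have "share (if b t = both then q else 0) \<in> prob_simplex 2" for t
    using q by (simp add: share_in_prob_simplex)
  ultimately show ?thesis
    using OPT_ge [of 2 T "\<lambda>t. share (if b t = both then q else 0)" b] by simp
qed

lemma ALG_law_le:
  assumes "\<And>t. t < T \<Longrightarrow> b t \<in> {sole, both}" "F both 0 = 0" "F sole 0 \<le> 1"
  shows "ALG 2 T F b \<le> (real T - walk both T b) / 2"
proof -
  have "ALG 2 T F b \<le> (\<Sum>t<T. b t 0 * F (b t) 0)"
    by (simp add: ALG_def egalitarian_2 cum_utility_def)
  \<comment> \<open>The new summand is 1 at \<open>sole\<close> and 0 at \<open>both\<close>: agent
    0 lives on the uncontested periods alone.\<close>
  also have "\<dots> \<le> (\<Sum>t<T. 1 / 2 - 1 / 2 * (if b t = both then 1 else -1))"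
    by (intro sum_mono) (use assms in force)
  also have "\<dots> = (real T - walk both T b) / 2"
    unfolding sum_subtractf sum_distrib_left [symmetric] walk_def by (simp add: diff_divide_distrib)
  finally show ?thesis .
qed

text \<open>Pointwise, the regret is at least half the positive part of the walk, which turns the
  constant 1/16 into 1/32.\<close>

lemma regret_law_ge:
  assumes F: "F \<in> static_policies 2 law" "F both 0 = 0" and T: "T \<ge> 1"
  shows "sqrt (real T) / 32 \<le> regret 2 law T F"
proof -
  have F_simplex: "F \<beta> \<in> prob_simplex 2" if "\<beta> \<in> {sole, both}" for \<beta>
    using F(1) that by (auto simp: static_policies_def)
  then have sole: "F sole 0 \<le> 1" by (force simp: prob_simplex_2)
  have "sqrt (real T) / 32 \<le>
      measure_pmf.expectation (iid_seq T law) (\<lambda>b. max 0 (walk both T b) / 2)"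
    using expectation_walk_pos_part [of sole both T] T by simp
  also have "\<dots> \<le> regret 2 law T F"
    unfolding regret_def
  proof (intro integral_mono_AE AE_pmfI integrable_iid_seq)
    fix b assume "b \<in> set_pmf (iid_seq T law)"
    then have b: "b t \<in> {sole, both}" if "t < T" for t
      using iid_seq_in_support [of b T law t] that by simp
    \<comment> \<open>This settles the sequences with a negative walk, where the positive part
      vanishes.\<close>
    have "ALG 2 T F b \<le> OPT 2 T b"
      unfolding ALG_def by (rule OPT_ge) (auto intro!: F_simplex dest: b)
    moreover have "ALG 2 T F b \<le> (real T - walk both T b) / 2"
      using b F(2) sole by (rule ALG_law_le)
    moreover have "real T / 2 \<le> OPT 2 T b" if "walk both T b \<ge> 0"
      using b that T by (rule OPT_law_ge)
    ultimately show "max 0 (walk both T b) / 2 \<le> OPT 2 T b - ALG 2 T F b"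
      by (auto simp: max_def field_simps)
  qed auto
  finally show ?thesis .
qed

theorem lemma4:
  shows "\<exists>n P. n \<ge> 1 \<and> admissible n P \<and>
    (\<forall>F. (\<exists>T\<ge>1. F \<in> fluid_policies n P T) \<longrightarrow>
       0 < liminf (\<lambda>T. ereal (regret n P T F / sqrt (real T))))"
proof (intro exI conjI allI impI)
  show "admissible 2 law" by (rule admissible_law)
  fix F assume "\<exists>T\<ge>1. F \<in> fluid_policies 2 law T"
  \<comment> \<open>Neither property mentions the horizon, so a policy that is fluid at one horizon
    obeys the regret bound at all of them.\<close>
  then have F: "F \<in> static_policies 2 law" "F both 0 = 0"
    using fluid_policy_both by (auto simp: fluid_policies_def)
  have "ereal (1 / 32) \<le> liminf (\<lambda>T. ereal (regret 2 law T F / sqrt (real T)))"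
  proof (rule Liminf_bounded, rule eventually_sequentiallyI)
    fix T :: nat assume "T \<ge> 1"
    then show "ereal (1 / 32) \<le> ereal (regret 2 law T F / sqrt (real T))"
      using regret_law_ge [OF F] by (simp add: field_simps)
  qed
  then show "0 < liminf (\<lambda>T. ereal (regret 2 law T F / sqrt (real T)))"
    by (rule less_le_trans [rotated]) simp
qed simp

end
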